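(* Let $A\in M_2(\mathbb{Z})$ be an expanding matrix with characteristic polynomial $f(x)=x^2+bx+c$ ($b,c\in\mathbb{Z}$), let $m\geq 1$ be an integer, and let $\mathcal{D}=\{0,1,\dots,m\}v=\{0,v,2v,\dots,mv\}$ where $v\in\mathbb{R}^2$ is such that $\{v,Av\}$ is linearly independent. Suppose that $\Delta=b^2-4c<0$. Then, in each of the cases $b^2=3c$, $b^2=2c$, $b^2=c$, $b=0$, the set $T(A,\mathcal{D})$ is connected if and only if $$m\geq \begin{cases}\max\{c-|b|+1,\ |b|-1\} & \text{if } b^2=3c,\\ c-|b|+1 & \text{if } b^2=2c \text{ or } b^2=c,\\ c-1 & \text{if } b=0.\end{cases}$$
   Context: A matrix $A\in M_n(\mathbb{Z})$ is expanding if all its (complex) eigenvalues have moduli strictly greater than $1$. For an expanding $A\in M_n(\mathbb{Z})$ and a finite set $\mathcal{D}\subset\mathbb{R}^n$ (a digit set), the self-affine set $T(A,\mathcal{D})$ is the unique non-empty compact set $T\subset\mathbb{R}^n$ satisfying $T=\bigcup_{d\in\mathcal{D}}A^{-1}(T+d)$; equivalently $T=\left\{\sum_{i=1}^\infty A^{-i}d_{j_i}: d_{j_i}\in\mathcal{D}\right\}$. *)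

theory Defs
  imports "HOL-Analysis.Analysis" "HOL-Computational_Algebra.Polynomial"
begin

text \<open>The characteristic polynomial \<open>det (x I - A)\<close>, computed as a determinant over the
  polynomial ring.\<close>

definition charpoly :: "'a::comm_ring_1^'n^'n \<Rightarrow> 'a poly" where
  "charpoly A = det (mat [:0, 1:] - map_matrix (\<lambda>a. [:a:]) A)"

definition eigenvalue :: "'a::field^'n^'n \<Rightarrow> 'a \<Rightarrow> bool" where
  "eigenvalue A z \<longleftrightarrow> (\<exists>u. u \<noteq> 0 \<and> A *v u = z *s u)"

definition expanding :: "int^'n^'n \<Rightarrow> bool" where
  "expanding A \<longleftrightarrow> (\<forall>z::complex. eigenvalue (map_matrix of_int A) z \<longrightarrow> cmod z > 1)"

text \<open>Only meaningful for expanding \<open>A\<close> and finite non-empty \<open>D\<close>; then \<open>A\<close> is invertible over the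
  reals and exactly one set has the described property.\<close>

definition self_affine_set :: "int^'n^'n \<Rightarrow> (real^'n) set \<Rightarrow> (real^'n) set" where
  "self_affine_set A D =
    (THE T. T \<noteq> {} \<and> compact T \<and>
       T = (\<Union>d\<in>D. (\<lambda>x. matrix_inv (map_matrix of_int A) *v (x + d)) ` T))"

end

theory Submission
  imports Defs
begin

text \<open>Let \<open>l\<close> be a non-real root of \<open>X\<^sup>2 + b X + c\<close>, so that \<open>(cmod l)\<^sup>2 = c\<close>. Sending \<open>1\<close> to \<open>v\<close> and \<open>l\<close> to
  \<open>A v\<close> identifies \<open>\<complex>\<close> with the plane and multiplication by \<open>l\<close> with \<open>A\<close>, so the self-affine set
  becomes the attractor \<open>K\<close> of the similarities \<open>x \<mapsto> (x + j) / l\<close>, \<open>0 \<le> j \<le> m\<close>. Its difference set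
  \<open>K - K\<close> is the attractor for the digits \<open>-m, \<dots>, m\<close> and contains every bounded set \<open>Z\<close> such that each
  \<open>z \<in> Z\<close> has a digit \<open>e\<close> with \<open>l z - e \<in> Z\<close>. If \<open>1 \<in> K - K\<close>, then \<open>K\<close> is connected; if \<open>K\<close> is
  connected, then \<open>K - K\<close> contains a positive integer.

  For the sufficiency of the bounds, \<open>Z = {1, w, -w}\<close> with \<open>w = l + b - sgn b\<close> works if \<open>b \<noteq> 0\<close>, and
  \<open>Z = {1, l, -1, -l}\<close> if \<open>b = 0\<close>. For the necessity, a bounded orbit \<open>x\<^bsub>n+1\<^esub> = l x\<^bsub>n\<^esub> - e\<^bsub>n\<^esub>\<close> starting at
  a positive integer is projected to \<open>y\<^bsub>n\<^esub> = Im x\<^bsub>n\<^esub> / Im l\<close>, which satisfies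
  \<open>y\<^bsub>n+2\<^esub> + b y\<^bsub>n+1\<^esub> + c y\<^bsub>n\<^esub> = - e\<^bsub>n\<^esub>\<close>. In each of the four cases some power \<open>l\<^sup>p\<close> is real, so \<open>p\<close> steps of
  this recurrence multiply \<open>y\<close> by \<open>l\<^sup>p\<close> up to an explicit error linear in \<open>m\<close>; boundedness
  bounds \<open>m\<close> from below.\<close>

section \<open>The Hutchinson operator of the digit maps and its attractor\<close>

definition digit_step :: "complex \<Rightarrow> complex set \<Rightarrow> complex set \<Rightarrow> complex set" where
  "digit_step l D X = (\<Union>d\<in>D. (\<lambda>x. (x + d) / l) ` X)"

lemma digit_step_mono: "X \<subseteq> Y \<Longrightarrow> digit_step l D X \<subseteq> digit_step l D Y"
  unfolding digit_step_def by blast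

lemma digit_step_memI: "d \<in> D \<Longrightarrow> x \<in> X \<Longrightarrow> (x + d) / l \<in> digit_step l D X"
  unfolding digit_step_def by blast

lemma mem_digit_step_iff:
  assumes "l \<noteq> 0"
  shows "x \<in> digit_step l D X \<longleftrightarrow> (\<exists>d\<in>D. l * x - d \<in> X)"
proof
  assume "x \<in> digit_step l D X"
  then show "\<exists>d\<in>D. l * x - d \<in> X"
    using assms by (force simp: digit_step_def)
next
  assume "\<exists>d\<in>D. l * x - d \<in> X"
  then obtain d where d: "d \<in> D" "l * x - d \<in> X" by blast
  moreover have "x = ((l * x - d) + d) / l" using assms by simp
  ultimately show "x \<in> digit_step l D X" using digit_step_memI by metis
qed

lemma compact_digit_step:
  assumes "finite D" "compact X"
  shows "compact (digit_step l D X)"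
  unfolding digit_step_def divide_inverse
  by (intro compact_UN assms compact_continuous_image continuous_intros)

text \<open>Each application of the hypothesis on \<open>X\<close> shrinks the distance to \<open>K\<close> by the factor
  \<open>1 / cmod l\<close>, so the supremum of these distances over \<open>X\<close> vanishes.\<close>

lemma bounded_subset_digit_step_closed:
  assumes l: "cmod l > 1" and X: "bounded X" "X \<subseteq> digit_step l E X"
    and K: "closed K" "K \<noteq> {}" "digit_step l E K \<subseteq> K"
  shows "X \<subseteq> K"
proof (cases "X = {}")
  case False
  define h where "h = (SUP x\<in>X. infdist x K)"
  obtain k0 where k0: "k0 \<in> K" using K by blast
  obtain B where B: "\<And>x. x \<in> X \<Longrightarrow> dist k0 x \<le> B"
    using X(1) bounded_any_center[of X k0] by blast
  have bdd: "bdd_above ((\<lambda>x. infdist x K) ` X)"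
    by (rule bdd_aboveI[of _ B]) (use k0 B in \<open>auto intro!: infdist_le2 simp: dist_commute\<close>)
  have le: "infdist x K \<le> h" if "x \<in> X" for x
    unfolding h_def by (rule cSUP_upper[OF that bdd])
  have step: "infdist x K \<le> h / cmod l" if x: "x \<in> X" for x
  proof -
    obtain e where e: "e \<in> E" "l * x - e \<in> X"
      using x X(2) l mem_digit_step_iff[of l x E X] by fastforce
    obtain k where k: "k \<in> K" "infdist (l * x - e) K = dist (l * x - e) k"
      using infdist_attains_inf[OF K(1,2)] by blast
    have "(k + e) / l \<in> K" using K(3) digit_step_memI[OF e(1) k(1)] by blast
    then have "infdist x K \<le> dist x ((k + e) / l)" by (rule infdist_le)
    also have "x - (k + e) / l = (l * x - e - k) / l"
      using l by (cases "l = 0") (auto simp: field_simps)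
    then have "dist x ((k + e) / l) = dist (l * x - e) k / cmod l"
      by (simp add: dist_norm norm_divide)
    also have "\<dots> \<le> h / cmod l"
      using le[OF e(2)] k l by (simp add: divide_right_mono)
    finally show ?thesis .
  qed
  have "h \<le> h / cmod l"
    unfolding h_def using False step by (intro cSUP_least) (auto simp: h_def)
  then have "h \<le> 0" using l
    by (smt (verit) divide_less_eq mult_less_cancel_left1)
  then have "infdist x K = 0" if "x \<in> X" for x
    using le[OF that] infdist_nonneg[of x K] by linarith
  then show ?thesis using in_closed_iff_infdist_zero[OF K(1,2)] by blast
qed simp

definition attractor :: "complex \<Rightarrow> complex set \<Rightarrow> complex set \<Rightarrow> bool" where
  "attractor l D K \<longleftrightarrow> K \<noteq> {} \<and> compact K \<and> K = digit_step l D K"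

lemma attractor_unique:
  assumes "cmod l > 1" "attractor l D K" "attractor l D K'"
  shows "K = K'"
  using assms bounded_subset_digit_step_closed[of l K D K']
    bounded_subset_digit_step_closed[of l K' D K]
  by (auto simp: attractor_def compact_imp_bounded compact_imp_closed)

text \<open>The radius is the fixed point of \<open>r \<mapsto> (r + B) / cmod l\<close>, which
  bounds how far one digit map can move a ball of radius \<open>r\<close> about 0.\<close>

lemma digit_step_cball_subset:
  assumes "cmod l > 1" "\<And>d. d \<in> D \<Longrightarrow> cmod d \<le> B"
  shows "digit_step l D (cball 0 (B / (cmod l - 1))) \<subseteq> cball 0 (B / (cmod l - 1))"
proof
  fix x assume "x \<in> digit_step l D (cball 0 (B / (cmod l - 1)))"
  then obtain d y where d: "d \<in> D" and y: "cmod y \<le> B / (cmod l - 1)" and x: "x = (y + d) / l"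
    by (auto simp: digit_step_def)
  have "cmod (y + d) \<le> B / (cmod l - 1) + B"
    using y assms(2)[OF d] norm_triangle_ineq[of y d] by linarith
  also have "\<dots> = B / (cmod l - 1) * cmod l" using assms(1) by (simp add: field_simps)
  finally show "x \<in> cball 0 (B / (cmod l - 1))"
    using assms(1) by (auto simp: x norm_divide divide_le_eq mult.commute)
qed

text \<open>Iterating the operator on an invariant ball gives nested non-empty compact sets, and
  their intersection is a fixed point. The iterates stay visible in the statement so that
  connectedness can later be passed to the limit.\<close>

lemma attractor_Inter_iterates:
  assumes l: "cmod l > 1" and D: "finite D" "D \<noteq> {}"
    and B: "\<And>d. d \<in> D \<Longrightarrow> cmod d \<le> B"
    and X_def: "X = (\<lambda>n. (digit_step l D ^^ n) (cball 0 (B / (cmod l - 1))))"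
  shows "attractor l D (\<Inter>n. X n)" "compact (X n)" "m \<le> n \<Longrightarrow> X n \<subseteq> X m"
proof -
  have B0: "B \<ge> 0" using D(2) B by (meson all_not_in_conv norm_ge_zero order_trans)
  have X_Suc: "X (Suc n) = digit_step l D (X n)" for n by (simp add: X_def)
  show comp: "compact (X n)" for n
    by (induction n) (auto simp: X_Suc intro: compact_digit_step D, simp add: X_def)
  have "X (Suc n) \<subseteq> X n" for n
  proof (induction n)
    case 0
    show ?case using digit_step_cball_subset[OF l B, of D] by (simp add: X_def)
  next
    case (Suc n)
    then show ?case using digit_step_mono X_Suc by metis
  qed
  then show anti: "m \<le> n \<Longrightarrow> X n \<subseteq> X m" for m n
    by (rule lift_Suc_antimono_le)
  have ne: "X n \<noteq> {}" for n
  proof (induction n)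
    case 0
    have "0 \<le> B / (cmod l - 1)" using B0 l by simp
    then show ?case by (simp add: X_def del: divide_le_0_iff)
  next
    case (Suc n)
    then show ?case using D(2) by (auto simp: X_Suc digit_step_def)
  qed
  have "(\<Inter>n. X n) \<subseteq> digit_step l D (\<Inter>n. X n)"
  proof
    fix x assume x: "x \<in> (\<Inter>n. X n)"
    have l0: "l \<noteq> 0" using l by auto
    show "x \<in> digit_step l D (\<Inter>n. X n)"
    proof (rule ccontr)
      assume "x \<notin> digit_step l D (\<Inter>n. X n)"
      then have "\<forall>d\<in>D. \<exists>n. l * x - d \<notin> X n" by (auto simp: mem_digit_step_iff[OF l0])
      then obtain N where N: "\<And>d. d \<in> D \<Longrightarrow> l * x - d \<notin> X (N d)" by metis
      \<comment> \<open>As \<open>X\<close> decreases and \<open>D\<close> is finite, all digits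
        that fail at some level \<open>N d\<close> fail together at the largest one. Membership of
        \<open>x\<close> one level further up provides a digit that does not.\<close>
      have "x \<in> X (Suc (Max (N ` D)))" using x by blast
      then obtain d where d: "d \<in> D" "l * x - d \<in> X (Max (N ` D))"
        by (auto simp: X_Suc mem_digit_step_iff[OF l0])
      have "N d \<le> Max (N ` D)" using d D by simp
      then show False using anti d N by blast
    qed
  qed
  moreover have "digit_step l D (\<Inter>n. X n) \<subseteq> X n" for n
  proof -
    have "digit_step l D (\<Inter>n. X n) \<subseteq> X (Suc n)"
      unfolding X_Suc by (rule digit_step_mono) blast
    then show ?thesis using anti[of n "Suc n"] by auto
  qed
  moreover have "compact (\<Inter>n. X n)"
    using comp by (intro compact_Inter) auto
  moreover have "(\<Inter>n. X n) \<noteq> {}"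
    using compact_nest[of X, OF comp ne] anti by simp
  ultimately show "attractor l D (\<Inter>n. X n)"
    unfolding attractor_def by blast
qed

lemma attractor_exists:
  assumes "cmod l > 1" "finite D" "D \<noteq> {}"
  shows "\<exists>K. attractor l D K"
proof -
  have "cmod d \<le> Max (cmod ` D)" if "d \<in> D" for d using assms that by simp
  then show ?thesis using attractor_Inter_iterates(1)[OF assms _ refl] by blast
qed

section \<open>Connectedness of the attractor and its difference set\<close>

lemma connected_UN_atMost:
  assumes "\<And>j. j \<le> m \<Longrightarrow> connected (P j)"
    and "\<And>j. j < m \<Longrightarrow> P j \<inter> P (Suc j) \<noteq> {}"
  shows "connected (\<Union>j\<in>{0..m::nat}. P j)"
  using assms
proof (induction m)
  case (Suc m)
  have "connected ((\<Union>j\<in>{0..m}. P j) \<union> P (Suc m))"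
  proof (rule connected_Un)
    show "(\<Union>j\<in>{0..m}. P j) \<inter> P (Suc m) \<noteq> {}"
      using Suc.prems(2)[of m] by fastforce
  qed (use Suc in auto)
  then show ?case by (simp add: atLeast0_atMost_Suc Un_commute)
qed simp

text \<open>The pieces for the digits \<open>j\<close> and \<open>j + 1\<close> share the point
  \<open>(t + j) / l = (t' + j + 1) / l\<close>. Since \<open>t\<close> and \<open>t'\<close> lie in
  every iterate of the ball, each iterate is a chain of overlapping connected pieces, and a nested
  intersection of compact connected sets is connected.\<close>

lemma attractor_connectedI:
  assumes l: "cmod l > 1" and K: "attractor l (of_nat ` {0..m}) K"
    and t: "t \<in> K" "t' \<in> K" "t = t' + 1"
  shows "connected K"
proof -
  define D where "D = (of_nat ` {0..m} :: complex set)"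
  have D: "finite D" "D \<noteq> {}" by (auto simp: D_def)
  have B: "cmod d \<le> real m" if "d \<in> D" for d using that by (auto simp: D_def)
  define X where "X = (\<lambda>n. (digit_step l D ^^ n) (cball 0 (real m / (cmod l - 1))))"
  note X = attractor_Inter_iterates[OF l D B X_def]
  have KX: "K = (\<Inter>n. X n)"
    using attractor_unique[OF l K[folded D_def] X(1)] .
  have "connected (X n)" for n
  proof (induction n)
    case 0
    show ?case by (simp add: X_def)
  next
    case (Suc n)
    have "connected (\<Union>j\<in>{0..m}. (\<lambda>x. (x + of_nat j) / l) ` X n)"
    proof (rule connected_UN_atMost)
      fix j
      show "connected ((\<lambda>x. (x + of_nat j) / l) ` X n)"
        unfolding divide_inverse
        by (intro connected_continuous_image Suc.IH continuous_intros)
      have "(t + of_nat j) / l = (t' + of_nat (Suc j)) / l" using t by simp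
      moreover have "t \<in> X n" "t' \<in> X n" using t KX by auto
      ultimately show "(\<lambda>x. (x + of_nat j) / l) ` X n \<inter> (\<lambda>x. (x + of_nat (Suc j)) / l) ` X n \<noteq> {}"
        by blast
    qed
    then show ?case by (simp add: X_def digit_step_def D_def)
  qed
  then show ?thesis unfolding KX using X(2,3) by (intro connected_nest) auto
qed

text \<open>The piece for the digit 0 and the union of the other pieces are closed, non-empty and
  cover \<open>K\<close>, so connectedness makes them meet. A common point has the form
  \<open>t / l = (t' + j) / l\<close> with \<open>j \<ge> 1\<close>.\<close>

lemma attractor_connectedD:
  assumes m: "m \<ge> 1" and K: "attractor l (of_nat ` {0..m}) K" "connected K" and l: "l \<noteq> 0"
  obtains t t' j where "t \<in> K" "t' \<in> K" "t = t' + of_nat j" "j \<ge> 1"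
proof -
  define P where "P = (\<lambda>j::nat. (\<lambda>x. (x + of_nat j) / l) ` K)"
  have cK: "compact K" "K \<noteq> {}" and K_eq: "K = (\<Union>j\<in>{0..m}. P j)"
    using K(1) by (auto simp: attractor_def digit_step_def P_def)
  have closed: "closed (P j)" for j
    unfolding P_def divide_inverse
    by (intro compact_imp_closed compact_continuous_image cK continuous_intros)
  have "{0..m} = insert 0 {1..m}" by auto
  then have eq: "K = P 0 \<union> (\<Union>j\<in>{1..m}. P j)" using K_eq by (metis UN_insert)
  have "P 0 \<inter> (\<Union>j\<in>{1..m}. P j) \<noteq> {}"
  proof
    assume "P 0 \<inter> (\<Union>j\<in>{1..m}. P j) = {}"
    moreover have "closed (\<Union>j\<in>{1..m}. P j)" using closed by blast
    moreover have "P 0 \<noteq> {}" "P 1 \<noteq> {}" using cK by (auto simp: P_def)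
    ultimately show False
      using K(2) closed[of 0] m eq unfolding connected_closed
      by (metis (no_types, lifting) Int_absorb1 SUP_upper Un_upper1 Un_upper2 atLeastAtMost_iff
          inf.absorb_iff2 inf_bot_left inf_commute order_refl subset_empty)
  qed
  then obtain j t t' where "j \<ge> 1" "t \<in> K" "t' \<in> K" "t / l = (t' + of_nat j) / l"
    unfolding P_def using l by fastforce
  then show ?thesis using that l by simp
qed

lemma attractor_differences:
  assumes l: "l \<noteq> 0" and K: "attractor l (of_nat ` {0..m}) K"
  shows "attractor l (of_int ` {-int m..int m}) {x - y | x y. x \<in> K \<and> y \<in> K}"
    (is "attractor l ?E ?S")
proof -
  have cK: "compact K" "K \<noteq> {}" and K_eq: "K = digit_step l (of_nat ` {0..m}) K"
    using K by (auto simp: attractor_def)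
  have "z \<in> digit_step l ?E ?S" if "z \<in> ?S" for z
  proof -
    obtain x y where "x \<in> K" "y \<in> K" and z: "z = x - y" using \<open>z \<in> ?S\<close> by blast
    then have "x \<in> digit_step l (of_nat ` {0..m}) K" "y \<in> digit_step l (of_nat ` {0..m}) K"
      using K_eq by auto
    then obtain i j where ij: "i \<le> m" "j \<le> m" "l * x - of_nat i \<in> K" "l * y - of_nat j \<in> K"
      by (auto simp: mem_digit_step_iff[OF l])
    have "l * z - of_int (int i - int j) = (l * x - of_nat i) - (l * y - of_nat j)"
      by (simp add: z algebra_simps)
    then have "l * z - of_int (int i - int j) \<in> ?S" using ij by blast
    moreover have "int i - int j \<in> {-int m..int m}" using ij by auto
    ultimately show ?thesis unfolding mem_digit_step_iff[OF l] by blast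
  qed
  moreover have "z \<in> ?S" if z: "z \<in> digit_step l ?E ?S" for z
  proof -
    obtain x y e where xy: "x \<in> K" "y \<in> K" and e: "e \<in> {-int m..int m}"
      and z: "z = ((x - y) + of_int e) / l"
      using z unfolding digit_step_def by blast
    \<comment> \<open>A digit \<open>e\<close> of the difference set is split into its positive part
      \<open>nat e\<close> and its negative part \<open>nat (-e)\<close>; both lie in
      \<open>{0..m}\<close>.\<close>
    have "(x + of_nat (nat e)) / l \<in> K" "(y + of_nat (nat (-e))) / l \<in> K"
      by (subst K_eq, rule digit_step_memI, use e xy in force, fact)+
    moreover have "z = (x + of_nat (nat e)) / l - (y + of_nat (nat (-e))) / l"
    proof -
      have "(of_int e :: complex) = of_nat (nat e) - of_nat (nat (-e))"
        by (cases "e \<ge> 0") auto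
      then show ?thesis by (simp add: z diff_divide_distrib add_divide_distrib)
    qed
    ultimately show ?thesis by blast
  qed
  ultimately have "?S = digit_step l ?E ?S" by blast
  moreover have "?S \<noteq> {}" using cK by blast
  ultimately show ?thesis
    using compact_differences[OF cK(1) cK(1)] by (simp add: attractor_def)
qed

text \<open>The step condition says \<open>Z \<subseteq> digit_step l E Z\<close> for the digits
  \<open>E\<close> from \<open>-m\<close> to \<open>m\<close>, so \<open>Z\<close> lies in the
  difference set. Hence 1 is a difference of two points of \<open>K\<close>, as
  \<open>attractor_connectedI\<close> requires.\<close>

lemma attractor_connected_of_orbit_set:
  assumes l: "cmod l > 1" and K: "attractor l (of_nat ` {0..m}) K"
    and Z: "bounded Z" "1 \<in> Z"
    and step: "\<And>z. z \<in> Z \<Longrightarrow> \<exists>e::int. \<bar>e\<bar> \<le> int m \<and> l * z - of_int e \<in> Z"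
  shows "connected K"
proof -
  let ?S = "{x - y | x y. x \<in> K \<and> y \<in> K}"
  have l0: "l \<noteq> 0" using l by auto
  note S = attractor_differences[OF l0 K]
  have "Z \<subseteq> digit_step l (of_int ` {-int m..int m}) Z"
  proof
    fix z assume "z \<in> Z"
    then obtain e :: int where e: "\<bar>e\<bar> \<le> int m" "l * z - of_int e \<in> Z" using step by blast
    then have "e \<in> {-int m..int m}" by auto
    with e show "z \<in> digit_step l (of_int ` {-int m..int m}) Z"
      unfolding mem_digit_step_iff[OF l0] by blast
  qed
  then have "Z \<subseteq> ?S"
    using bounded_subset_digit_step_closed[OF l Z(1)] S
    by (auto simp: attractor_def compact_imp_closed)
  then have "1 \<in> ?S" using Z(2) by blast
  then obtain x y where "x \<in> K" "y \<in> K" "1 = x - y" by blast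
  moreover from this have "x = y + 1" by (simp add: algebra_simps)
  ultimately show ?thesis using attractor_connectedI[OF l K] by blast
qed

lemma attractor_connected_obtains_orbit:
  assumes l: "cmod l > 1" and m: "m \<ge> 1"
    and K: "attractor l (of_nat ` {0..m}) K" "connected K"
  obtains x :: "nat \<Rightarrow> complex" and e :: "nat \<Rightarrow> int" and j :: nat
  where "j \<ge> 1" "x 0 = of_nat j" "bounded (range x)"
    "\<And>n. \<bar>e n\<bar> \<le> int m" "\<And>n. x (Suc n) = l * x n - of_int (e n)"
proof -
  let ?S = "{x - y | x y. x \<in> K \<and> y \<in> K}" and ?E = "of_int ` {-int m..int m}"
  have l0: "l \<noteq> 0" using l by auto
  have S: "bounded ?S" "?S = digit_step l ?E ?S"
    using attractor_differences[OF l0 K(1)] by (auto simp: attractor_def compact_imp_bounded)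
  obtain t t' j where t: "t \<in> K" "t' \<in> K" "t = t' + of_nat j" and j: "j \<ge> (1::nat)"
    using attractor_connectedD[OF m K l0] by blast
  have "of_nat j = t - t'" using t by simp
  then have jS: "of_nat j \<in> ?S" using t by blast
  \<comment> \<open>The clause for \<open>n = 0\<close> pins the starting point of the sequence
    built by dependent choice.\<close>
  have "\<exists>x. \<forall>n. (x n \<in> ?S \<and> (n = 0 \<longrightarrow> x n = of_nat j)) \<and>
      (\<exists>e\<in>{-int m..int m}. x (Suc n) = l * x n - of_int e)"
  proof (rule dependent_nat_choice)
    fix z :: complex and n :: nat
    assume "z \<in> ?S \<and> (n = 0 \<longrightarrow> z = of_nat j)"
    then have "z \<in> digit_step l ?E ?S" using S(2) by blast
    then show "\<exists>y. (y \<in> ?S \<and> (Suc n = 0 \<longrightarrow> y = of_nat j)) \<and>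
        (\<exists>e\<in>{-int m..int m}. y = l * z - of_int e)"
      unfolding mem_digit_step_iff[OF l0] by blast
  qed (use jS in blast)
  then obtain x where x: "\<forall>n. (x n \<in> ?S \<and> (n = 0 \<longrightarrow> x n = of_nat j)) \<and>
      (\<exists>e\<in>{-int m..int m}. x (Suc n) = l * x n - of_int e)" ..
  then have "\<forall>n. \<exists>e. e \<in> {-int m..int m} \<and> x (Suc n) = l * x n - of_int e" by blast
  then obtain e where e: "\<forall>n. e n \<in> {-int m..int m} \<and> x (Suc n) = l * x n - of_int (e n)"
    by (rule choice[THEN exE])
  have "range x \<subseteq> ?S" using x by blast
  then have "bounded (range x)" using S(1) bounded_subset by blast
  moreover have "x 0 = of_nat j" using x by simp
  moreover have "\<bar>e n\<bar> \<le> int m" "x (Suc n) = l * x n - of_int (e n)" for n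
    using e[rule_format, of n] by auto
  ultimately show ?thesis by (intro that[OF j])
qed

section \<open>Bounded solutions of the recurrence and lower bounds for \<open>m\<close>\<close>

text \<open>The supremum \<open>h\<close> of the absolute values is finite and satisfies
  \<open>Q * h \<le> h + R\<close>.\<close>

lemma bounded_expanding_sequence_le:
  fixes y :: "nat \<Rightarrow> real"
  assumes "bounded (range y)" and Q: "Q > 1"
    and step: "\<And>n. Q * \<bar>y n\<bar> \<le> \<bar>y (n + p)\<bar> + R"
  shows "(Q - 1) * \<bar>y n\<bar> \<le> R"
proof -
  define h where "h = (SUP n. \<bar>y n\<bar>)"
  obtain B where "\<And>n. \<bar>y n\<bar> \<le> B" using assms(1) unfolding bounded_iff by auto
  then have le: "\<bar>y n\<bar> \<le> h" for n
    unfolding h_def by (intro cSUP_upper bdd_aboveI[of _ B]) auto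
  have "\<bar>y n\<bar> \<le> (h + R) / Q" for n
    using step[of n] le[of "n + p"] Q by (simp add: field_simps)
  then have "h \<le> (h + R) / Q" unfolding h_def by (intro cSUP_least) auto
  then have "(Q - 1) * h \<le> R" using Q by (simp add: field_simps)
  moreover have "(Q - 1) * \<bar>y n\<bar> \<le> (Q - 1) * h" using le Q by (intro mult_left_mono) auto
  ultimately show ?thesis by linarith
qed

lemma quadratic_root_parts:
  fixes b c :: int
  assumes root: "l\<^sup>2 + of_int b * l + of_int c = 0" and im: "Im l \<noteq> 0"
  shows "Re l = - of_int b / 2" "(cmod l)\<^sup>2 = of_int c"
proof -
  have "Im (l\<^sup>2 + of_int b * l + of_int c) = 0" "Re (l\<^sup>2 + of_int b * l + of_int c) = 0"
    using root by simp_all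
  then have i: "2 * Re l * Im l + of_int b * Im l = 0"
    and r: "(Re l)\<^sup>2 - (Im l)\<^sup>2 + of_int b * Re l + of_int c = 0"
    by (simp_all add: power2_eq_square algebra_simps)
  have "Im l * (2 * Re l + of_int b) = 0" using i by (simp add: algebra_simps)
  then have *: "2 * Re l + of_int b = 0" using im by simp
  then show "Re l = - of_int b / 2" by simp
  have "of_int b = - 2 * Re l" using * by simp
  with r have "(Re l)\<^sup>2 + (Im l)\<^sup>2 = of_int c"
    by (simp add: power2_eq_square)
  then show "(cmod l)\<^sup>2 = of_int c" by (simp add: cmod_power2)
qed

text \<open>Applying \<open>X^2 + b X + c\<close> to the shift cancels the terms in
  \<open>x n\<close> and leaves \<open>- (l + b) * e n - e (n + 1)\<close>. The imaginary part
  retains only \<open>e n\<close>; in the real part \<open>Re l + b = b / 2\<close>.\<close>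

lemma digit_orbit_recurrence:
  fixes b c :: int and x :: "nat \<Rightarrow> complex" and e :: "nat \<Rightarrow> int"
  assumes root: "l\<^sup>2 + of_int b * l + of_int c = 0" and im: "Im l \<noteq> 0"
    and x: "\<And>n. x (Suc n) = l * x n - of_int (e n)"
  shows "Im (x (n + 2)) / Im l + of_int b * (Im (x (n + 1)) / Im l) + of_int c * (Im (x n) / Im l)
      = - of_int (e n)" (is ?Im)
    and "Re (x (n + 2)) + of_int b * Re (x (n + 1)) + of_int c * Re (x n)
      = - of_int b / 2 * of_int (e n) - of_int (e (n + 1))" (is ?Re)
proof -
  have "x (n + 2) + of_int b * x (n + 1) + of_int c * x n
      = (l\<^sup>2 + of_int b * l + of_int c) * x n - (l + of_int b) * of_int (e n) - of_int (e (n + 1))"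
    by (simp add: x power2_eq_square algebra_simps)
  then have *: "x (n + 2) + of_int b * x (n + 1) + of_int c * x n
      = - ((l + of_int b) * of_int (e n)) - of_int (e (n + 1))"
    by (simp only: root) simp
  have "Im (x (n + 2) + of_int b * x (n + 1) + of_int c * x n) = - (Im l * of_int (e n))"
    by (simp only: *) simp
  then have "Im (x (n + 2)) + of_int b * Im (x (n + 1)) + of_int c * Im (x n)
      = - (Im l * of_int (e n))"
    by simp
  then show ?Im using im by (simp add: field_simps)
  have "Re (x (n + 2) + of_int b * x (n + 1) + of_int c * x n)
      = - ((Re l + of_int b) * of_int (e n)) - of_int (e (n + 1))"
    by (simp only: *) simp
  then show ?Re using quadratic_root_parts(1)[OF root im] by (simp add: algebra_simps)
qed

lemma abs_add_le: "\<bar>x\<bar> \<le> a \<Longrightarrow> \<bar>y\<bar> \<le> b \<Longrightarrow> \<bar>x + y\<bar> \<le> a + b" for x y :: real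
  by linarith

lemma abs_diff_le: "\<bar>x\<bar> \<le> a \<Longrightarrow> \<bar>y\<bar> \<le> b \<Longrightarrow> \<bar>x - y\<bar> \<le> a + b" for x y :: real
  by linarith

lemma abs_mult_le: "\<bar>y\<bar> \<le> b \<Longrightarrow> \<bar>x * y\<bar> \<le> \<bar>x\<bar> * b" for x y :: real
  by (simp add: abs_mult mult_left_mono)

lemma attractor_connected_obtains_recurrence:
  fixes b c :: int
  assumes l: "cmod l > 1" and root: "l\<^sup>2 + of_int b * l + of_int c = 0" and im: "Im l \<noteq> 0"
    and m: "m \<ge> 1" and K: "attractor l (of_nat ` {0..m}) K" "connected K"
  obtains y u :: "nat \<Rightarrow> real"
  where "bounded (range y)" "y 1 \<ge> 1" "\<And>n. \<bar>u n\<bar> \<le> real m"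
    "\<And>n. y (n + 2) = u n - of_int b * y (n + 1) - of_int c * y n"
proof -
  obtain x e j where j: "j \<ge> (1::nat)" "x 0 = complex_of_nat j"
    and x: "bounded (range x)" and e: "\<And>n. \<bar>e n\<bar> \<le> int m"
    and x_Suc: "\<And>n. x (Suc n) = l * x n - of_int (e n)"
    by (rule attractor_connected_obtains_orbit[OF l m K]) (rule that)
  define y where "y = (\<lambda>n. Im (x n) / Im l)"
  obtain B where B: "\<And>n. cmod (x n) \<le> B" using x unfolding bounded_iff by auto
  have "\<bar>y n\<bar> \<le> B / \<bar>Im l\<bar>" for n
  proof -
    have "\<bar>Im (x n)\<bar> \<le> B" using B[of n] abs_Im_le_cmod[of "x n"] by linarith
    then show ?thesis by (simp add: y_def divide_right_mono)
  qed
  then have "bounded (range y)" unfolding bounded_iff by auto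
  \<comment> \<open>Index 1 is the first informative one: \<open>x 0\<close> is real, so
    \<open>y 0 = 0\<close>, while \<open>y 1 = j\<close>.\<close>
  moreover have "y 1 \<ge> 1" using j im x_Suc[of 0] by (simp add: y_def)
  moreover have "\<bar>- real_of_int (e n)\<bar> \<le> real m" for n
    using e[of n] by linarith
  moreover have "y (n + 2) = - of_int (e n) - of_int b * y (n + 1) - of_int c * y n" for n
    using digit_orbit_recurrence(1)[where x = x and e = e, OF root im x_Suc, of n] unfolding y_def by linarith
  ultimately show ?thesis by (rule that)
qed

text \<open>Here \<open>l^2 = -c\<close>, so two steps already multiply by a real number, with error
  at most \<open>m\<close>.\<close>

lemma connected_attractor_lower_bound_b_zero:
  assumes l: "cmod l > 1" "l\<^sup>2 + of_int b * l + of_int c = 0" "Im l \<noteq> 0"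
    and m: "m \<ge> 1" and K: "attractor l (of_nat ` {0..m}) K" "connected K"
    and c: "c \<ge> 2" and b: "b = 0"
  shows "int m \<ge> c - 1"
proof -
  obtain y u :: "nat \<Rightarrow> real" where y: "bounded (range y)" "y 1 \<ge> 1"
    and u: "\<And>n. \<bar>u n\<bar> \<le> real m"
    and rec: "\<And>n. y (n + 2) = u n - of_int b * y (n + 1) - of_int c * y n"
    by (rule attractor_connected_obtains_recurrence[OF l m K]) (rule that)
  have "of_int c * \<bar>y n\<bar> \<le> \<bar>y (n + 2)\<bar> + real m" for n
  proof -
    have "of_int c * \<bar>y n\<bar> = \<bar>of_int c * y n\<bar>" using c by (simp add: abs_mult)
    also have "of_int c * y n = u n - y (n + 2)" using rec[of n] b by simp
    finally show ?thesis using u[of n] by linarith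
  qed
  then have "(of_int c - 1) * \<bar>y 1\<bar> \<le> real m"
    using c by (intro bounded_expanding_sequence_le[OF y(1), where p = 2]) auto
  moreover have "(of_int c - 1) * 1 \<le> (of_int c - 1) * \<bar>y 1\<bar>"
    using c y(2) by (intro mult_left_mono) auto
  ultimately have "real_of_int (c - 1) \<le> real_of_int (int m)" by simp
  then show ?thesis by (simp only: of_int_le_iff)
qed

text \<open>Here \<open>l^3 = b^3\<close>: \<open>X^2 + b X + b^2\<close> divides
  \<open>X^3 - b^3\<close> with cofactor \<open>X - b\<close>, whose coefficients give the error
  \<open>m (1 + |b|)\<close>. For \<open>m \<le> c - |b|\<close> this is at most
  \<open>|b|^3 - |b|\<close>, too small because \<open>|b| \<ge> 2\<close>.\<close>

lemma connected_attractor_lower_bound_b_sq_c: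
  assumes l: "cmod l > 1" "l\<^sup>2 + of_int b * l + of_int c = 0" "Im l \<noteq> 0"
    and m: "m \<ge> 1" and K: "attractor l (of_nat ` {0..m}) K" "connected K"
    and c: "c \<ge> 2" and b: "b\<^sup>2 = c"
  shows "int m \<ge> c - \<bar>b\<bar> + 1"
proof -
  obtain y u :: "nat \<Rightarrow> real" where y: "bounded (range y)" "y 1 \<ge> 1"
    and u: "\<And>n. \<bar>u n\<bar> \<le> real m"
    and rec: "\<And>n. y (n + 2) = u n - of_int b * y (n + 1) - of_int c * y n"
    by (rule attractor_connected_obtains_recurrence[OF l m K]) (rule that)
  define r where "r = real_of_int b"
  have c_eq: "real_of_int c = r * r" using b unfolding r_def by (simp flip: b add: power2_eq_square)
  have bb: "\<bar>b\<bar> * \<bar>b\<bar> = c" using b by (simp add: power2_eq_square)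
  have b2: "\<bar>b\<bar> \<ge> 2"
  proof (rule ccontr)
    assume "\<not> \<bar>b\<bar> \<ge> 2"
    then have "\<bar>b\<bar> * \<bar>b\<bar> \<le> 1 * 1" by (intro mult_mono) auto
    then show False using bb c by linarith
  qed
  define Q where "Q = \<bar>b\<bar> * c"
  have "2 * 2 \<le> Q" unfolding Q_def using b2 c by (intro mult_mono) auto
  have "of_int Q * \<bar>y n\<bar> \<le> \<bar>y (n + 3)\<bar> + real m * (1 + \<bar>r\<bar>)" for n
  proof -
    have "y (n + 3) = u (n + 1) - r * y (n + 2) - r * r * y (n + 1)"
      using rec[of "n + 1"] by (simp add: c_eq r_def numeral_eq_Suc)
    moreover have "y (n + 2) = u n - r * y (n + 1) - r * r * y n"
      using rec[of n] by (simp add: c_eq r_def)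
    ultimately have eq: "r * (r * r) * y n = y (n + 3) - u (n + 1) + r * u n" by algebra
    have "of_int Q * \<bar>y n\<bar> = \<bar>r * (r * r) * y n\<bar>"
      using c c_eq by (simp add: Q_def r_def abs_mult)
    also have "\<dots> \<le> \<bar>y (n + 3)\<bar> + \<bar>u (n + 1)\<bar> + \<bar>r\<bar> * \<bar>u n\<bar>"
      unfolding eq by (simp flip: abs_mult)
    also have "\<dots> \<le> \<bar>y (n + 3)\<bar> + real m + \<bar>r\<bar> * real m"
      using u by (intro add_mono mult_left_mono) auto
    finally show ?thesis by (simp add: algebra_simps)
  qed
  then have "(of_int Q - 1) * \<bar>y 1\<bar> \<le> real m * (1 + \<bar>r\<bar>)"
    using \<open>2 * 2 \<le> Q\<close> by (intro bounded_expanding_sequence_le[OF y(1), where p = 3]) auto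
  moreover have "(of_int Q - 1) * 1 \<le> (of_int Q - 1) * \<bar>y 1\<bar>"
    using \<open>2 * 2 \<le> Q\<close> y(2) by (intro mult_left_mono) auto
  ultimately have "real_of_int (Q - 1) \<le> real_of_int (int m * (1 + \<bar>b\<bar>))"
    by (simp add: r_def)
  then have main: "Q - 1 \<le> int m * (1 + \<bar>b\<bar>)" by (simp only: of_int_le_iff)
  show ?thesis
  proof (rule ccontr)
    assume "\<not> ?thesis"
    then have "int m * (1 + \<bar>b\<bar>) \<le> (c - \<bar>b\<bar>) * (1 + \<bar>b\<bar>)" by (intro mult_right_mono) auto
    also have "\<dots> = Q - \<bar>b\<bar>" using bb by (simp add: Q_def algebra_simps)
    finally show False using main b2 by linarith
  qed
qed

text \<open>Here \<open>l^4 = -c^2\<close>: the product of \<open>X^2 + b X + c\<close> and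
  \<open>X^2 - b X + c\<close> is \<open>X^4 + c^2\<close>, and the second factor gives the error
  \<open>m (1 + |b| + c)\<close>.\<close>

lemma connected_attractor_lower_bound_b_sq_2c:
  assumes l: "cmod l > 1" "l\<^sup>2 + of_int b * l + of_int c = 0" "Im l \<noteq> 0"
    and m: "m \<ge> 1" and K: "attractor l (of_nat ` {0..m}) K" "connected K"
    and c: "c \<ge> 2" and b: "b\<^sup>2 = 2 * c"
  shows "int m \<ge> c - \<bar>b\<bar> + 1"
proof -
  obtain y u :: "nat \<Rightarrow> real" where y: "bounded (range y)" "y 1 \<ge> 1"
    and u: "\<And>n. \<bar>u n\<bar> \<le> real m"
    and rec: "\<And>n. y (n + 2) = u n - of_int b * y (n + 1) - of_int c * y n"
    by (rule attractor_connected_obtains_recurrence[OF l m K]) (rule that)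
  define r s where "r = real_of_int b" and "s = real_of_int c"
  have "real_of_int (b\<^sup>2) = real_of_int (2 * c)" using b by simp
  then have rr: "r * r = 2 * s" by (simp add: r_def s_def power2_eq_square)
  have bb: "\<bar>b\<bar> * \<bar>b\<bar> = 2 * c" using b by (simp add: power2_eq_square)
  have s: "s \<ge> 2" using c by (simp add: s_def)
  define Q where "Q = c * c"
  have Q: "2 * 2 \<le> Q" unfolding Q_def using c by (intro mult_mono) auto
  have "of_int Q * \<bar>y n\<bar> \<le> \<bar>y (n + 4)\<bar> + real m * (1 + \<bar>r\<bar> + s)" for n
  proof -
    have "y (n + 4) = u (n + 2) - r * y (n + 3) - s * y (n + 2)"
      using rec[of "n + 2"] by (simp add: s_def r_def numeral_eq_Suc)
    moreover have "y (n + 3) = u (n + 1) - r * y (n + 2) - s * y (n + 1)"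
      using rec[of "n + 1"] by (simp add: s_def r_def numeral_eq_Suc)
    moreover have "y (n + 2) = u n - r * y (n + 1) - s * y n"
      using rec[of n] by (simp add: s_def r_def)
    ultimately have eq: "s * s * y n = u (n + 2) - r * u (n + 1) + s * u n - y (n + 4)"
      using rr by algebra
    have "of_int Q * \<bar>y n\<bar> = \<bar>s * s * y n\<bar>"
      using s by (simp add: Q_def s_def abs_mult)
    also have "\<dots> \<le> real m + \<bar>r\<bar> * real m + \<bar>s\<bar> * real m + \<bar>y (n + 4)\<bar>"
      unfolding eq by (intro abs_add_le abs_diff_le abs_mult_le u order_refl)
    finally show ?thesis using s by (simp add: algebra_simps)
  qed
  then have "(of_int Q - 1) * \<bar>y 1\<bar> \<le> real m * (1 + \<bar>r\<bar> + s)"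
    using Q by (intro bounded_expanding_sequence_le[OF y(1), where p = 4]) auto
  moreover have "(of_int Q - 1) * 1 \<le> (of_int Q - 1) * \<bar>y 1\<bar>"
    using Q y(2) by (intro mult_left_mono) auto
  ultimately have "real_of_int (Q - 1) \<le> real_of_int (int m * (1 + \<bar>b\<bar> + c))"
    by (simp add: r_def s_def)
  then have main: "Q - 1 \<le> int m * (1 + \<bar>b\<bar> + c)" by (simp only: of_int_le_iff)
  show ?thesis
  proof (rule ccontr)
    assume "\<not> ?thesis"
    then have "int m * (1 + \<bar>b\<bar> + c) \<le> (c - \<bar>b\<bar>) * (1 + \<bar>b\<bar> + c)"
      using c by (intro mult_right_mono) auto
    also have "\<dots> = Q - c - \<bar>b\<bar>" using bb by (simp add: Q_def algebra_simps)
    finally show False using main c by linarith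
  qed
qed

text \<open>If \<open>r\<^sup>2 = 3 s\<close>, then \<open>X\<^sup>2 + r X + s\<close> divides \<open>X\<^sup>6 + s\<^sup>3\<close>, with the cofactor
  \<open>X\<^sup>4 - r X\<^sup>3 + 2 s X\<^sup>2 - r s X + s\<^sup>2\<close>.\<close>

lemma recurrence_six_steps:
  fixes y u :: "nat \<Rightarrow> real"
  assumes rec: "\<And>n. y (n + 2) = u n - r * y (n + 1) - s * y n" and rr: "r * r = 3 * s"
  shows "s * s * s * y n = u (n + 4) - r * u (n + 3) + 2 * s * u (n + 2)
    - r * s * u (n + 1) + s * s * u n - y (n + 6)"
proof -
  have u: "u k = y (k + 2) + r * y (k + 1) + s * y k" for k using rec[of k] by simp
  have "u (n + 4) - r * u (n + 3) + 2 * s * u (n + 2) - r * s * u (n + 1) + s * s * u n - y (n + 6)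
      = s * s * s * y n + (3 * s - r * r) * (y (n + 4) + s * y (n + 2))"
    unfolding u by (simp add: numeral_eq_Suc algebra_simps)
  then show ?thesis by (simp add: rr)
qed

text \<open>Here \<open>l^6 = -c^3\<close>. The absolute values of the cofactor's coefficients sum
  to \<open>(c + 1) (c + 1 + |b|)\<close>, which is the error per unit of \<open>m\<close>.\<close>

lemma connected_attractor_lower_bound_b_sq_3c:
  assumes l: "cmod l > 1" "l\<^sup>2 + of_int b * l + of_int c = 0" "Im l \<noteq> 0"
    and m: "m \<ge> 1" and K: "attractor l (of_nat ` {0..m}) K" "connected K"
    and c: "c \<ge> 2" and b: "b\<^sup>2 = 3 * c"
  shows "int m \<ge> c - \<bar>b\<bar> + 1"
proof -
  obtain y u :: "nat \<Rightarrow> real" where y: "bounded (range y)" "y 1 \<ge> 1"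
    and u: "\<And>n. \<bar>u n\<bar> \<le> real m"
    and rec: "\<And>n. y (n + 2) = u n - of_int b * y (n + 1) - of_int c * y n"
    by (rule attractor_connected_obtains_recurrence[OF l m K]) (rule that)
  define r s where "r = real_of_int b" and "s = real_of_int c"
  have "real_of_int (b\<^sup>2) = real_of_int (3 * c)" using b by simp
  then have rr: "r * r = 3 * s" by (simp add: r_def s_def power2_eq_square)
  have bb: "\<bar>b\<bar> * \<bar>b\<bar> = 3 * c" using b by (simp add: power2_eq_square)
  have s: "s \<ge> 2" using c by (simp add: s_def)
  define Q where "Q = c * c * c"
  have Q: "2 * 2 * 2 \<le> Q" unfolding Q_def using c by (intro mult_mono) auto
  have "of_int Q * \<bar>y n\<bar> \<le> \<bar>y (n + 6)\<bar> + real m * ((s + 1) * (s + 1 + \<bar>r\<bar>))" for n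
  proof -
    have eq: "s * s * s * y n = u (n + 4) - r * u (n + 3) + 2 * s * u (n + 2)
        - r * s * u (n + 1) + s * s * u n - y (n + 6)"
      by (rule recurrence_six_steps[OF _ rr]) (use rec in \<open>simp add: r_def s_def\<close>)
    have "of_int Q * \<bar>y n\<bar> = \<bar>s * s * s * y n\<bar>"
      using s by (simp add: Q_def s_def abs_mult)
    also have "\<dots> \<le> real m + \<bar>r\<bar> * real m + \<bar>2 * s\<bar> * real m
        + \<bar>r * s\<bar> * real m + \<bar>s * s\<bar> * real m + \<bar>y (n + 6)\<bar>"
      unfolding eq by (intro abs_add_le abs_diff_le abs_mult_le u order_refl)
    also have "\<dots> = \<bar>y (n + 6)\<bar> + real m * ((s + 1) * (s + 1 + \<bar>r\<bar>))"
      using s by (simp add: abs_mult algebra_simps)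
    finally show ?thesis .
  qed
  then have "(of_int Q - 1) * \<bar>y 1\<bar> \<le> real m * ((s + 1) * (s + 1 + \<bar>r\<bar>))"
    using Q by (intro bounded_expanding_sequence_le[OF y(1), where p = 6]) auto
  moreover have "(of_int Q - 1) * 1 \<le> (of_int Q - 1) * \<bar>y 1\<bar>"
    using Q y(2) by (intro mult_left_mono) auto
  ultimately have "real_of_int (Q - 1) \<le> real_of_int (int m * ((c + 1) * (c + 1 + \<bar>b\<bar>)))"
    by (simp add: r_def s_def)
  then have main: "Q - 1 \<le> int m * ((c + 1) * (c + 1 + \<bar>b\<bar>))" by (simp only: of_int_le_iff)
  show ?thesis
  proof (rule ccontr)
    assume "\<not> ?thesis"
    then have "int m * ((c + 1) * (c + 1 + \<bar>b\<bar>)) \<le> (c - \<bar>b\<bar>) * ((c + 1) * (c + 1 + \<bar>b\<bar>))"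
      using c by (intro mult_right_mono) auto
    also have "\<dots> = (c + 1) * (c * c + c - \<bar>b\<bar> - \<bar>b\<bar> * \<bar>b\<bar>)" by (simp add: algebra_simps)
    also have "\<dots> = (c + 1) * (c * c - 2 * c - \<bar>b\<bar>)" unfolding bb by simp
    also have "\<dots> = Q - c * c - 2 * c - (c + 1) * \<bar>b\<bar>" by (simp add: Q_def algebra_simps)
    finally have "c * c + 2 * c + (c + 1) * \<bar>b\<bar> \<le> 1" using main by linarith
    moreover have "c * c \<ge> 0" "(c + 1) * \<bar>b\<bar> \<ge> 0" using c by auto
    ultimately show False using c by linarith
  qed
qed

text \<open>For \<open>c = 3\<close> and \<open>m = 1\<close> the imaginary parts no longer exclude \<open>1\<close> from the differences of
  the attractor; the real parts do, by \<open>22 / 26 < 1\<close>.\<close>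

lemma attractor_not_connected_b_3_c_3:
  assumes l: "cmod l > 1" "l\<^sup>2 + of_int b * l + of_int 3 = 0" "Im l \<noteq> 0"
    and K: "attractor l (of_nat ` {0..1}) K" and b: "\<bar>b\<bar> = 3"
  shows "\<not> connected K"
proof
  assume "connected K"
  obtain x e j where j: "j \<ge> (1::nat)" "x 0 = complex_of_nat j"
    and x: "bounded (range x)" and e: "\<And>n. \<bar>e n\<bar> \<le> int 1"
    and x_Suc: "\<And>n. x (Suc n) = l * x n - of_int (e n)"
    by (rule attractor_connected_obtains_orbit[OF l(1) order_refl K \<open>connected K\<close>]) (rule that)
  define w u where "w = (\<lambda>n. Re (x n))" and "u = (\<lambda>n. real_of_int (e n))"
  have u: "\<bar>u n\<bar> \<le> 1" for n using e[of n] unfolding u_def by linarith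
  have rec: "w (n + 2) = - of_int b * w (n + 1) - 3 * w n - of_int b / 2 * u n - u (n + 1)" for n
    using digit_orbit_recurrence(2)[where x = x and e = e, OF l(2,3) x_Suc, of n]
    by (simp add: w_def u_def)
  have "bounded (range w)"
    unfolding w_def using x bounded_linear_image[OF _ bounded_linear_Re, of "range x"]
    by (simp add: image_image)
  moreover have "27 * \<bar>w n\<bar> \<le> \<bar>w (n + 6)\<bar> + 22" for n
  proof -
    define h where "h = real_of_int b / 2"
    have b_cases: "b = 3 \<or> b = - 3" using b by linarith
    then have hh: "2 * h * (2 * h) = 3 * 3" by (auto simp: h_def)
    define v where "v = (\<lambda>k. - h * u k - u (k + 1))"
    have "3 * 3 * 3 * w n = v (n + 4) - 2 * h * v (n + 3) + 2 * 3 * v (n + 2)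
        - 2 * h * 3 * v (n + 1) + 3 * 3 * v n - w (n + 6)"
      by (rule recurrence_six_steps[OF _ hh]) (use rec in \<open>simp add: h_def v_def\<close>)
    \<comment> \<open>Expanding \<open>v\<close> before taking absolute values matters:
      \<open>u (n + 2)\<close> cancels and the remaining coefficients sum to 1 + 3/2 + 3/2 + 9/2 +
      27/2 = 22. Bounding each \<open>v\<close> by 5/2 would only give 70.\<close>
    also have "\<dots> = - (w (n + 6)) - u (n + 5) + h * u (n + 4) + (2 * h * h - 6) * u (n + 3)
        + (6 * h * h - 9) * u (n + 1) - 9 * (h * u n)"
      by (simp add: v_def algebra_simps numeral_eq_Suc)
    also have "2 * h * h = 9 / 2" using hh by simp
    also have "6 * h * h = 27 / 2" using hh by simp
    finally have eq: "27 * w n = - w (n + 6) - u (n + 5) + h * u (n + 4) + - 3 / 2 * u (n + 3)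
        + 9 / 2 * u (n + 1) - 9 * h * u n"
      by simp
    have "\<bar>27 * w n\<bar> \<le> \<bar>- w (n + 6)\<bar> + 1 + \<bar>h\<bar> * 1 + \<bar>- 3 / 2\<bar> * 1 + \<bar>9 / 2\<bar> * 1 + \<bar>9 * h\<bar> * 1"
      unfolding eq
      by (intro abs_add_le abs_diff_le abs_mult_le u order_refl)
    moreover have "\<bar>h\<bar> = 3 / 2" using b_cases by (auto simp: h_def)
    ultimately show ?thesis by (simp add: abs_mult)
  qed
  ultimately have "(27 - 1) * \<bar>w 0\<bar> \<le> 22"
    by (intro bounded_expanding_sequence_le[where p = 6]) auto
  then show False using j by (simp add: w_def)
qed

section \<open>Sufficiency of the bounds by finite orbit sets\<close>

text \<open>Going from 1 to \<open>w\<close> costs a digit of size \<open>|b| - 1\<close>. From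
  \<open>l (l + b) = -c\<close> one gets \<open>l w = \<sigma> w + (|b| - c - 1)\<close>, so going
  from \<open>w\<close> to \<open>\<sigma> w\<close> costs a digit of size
  \<open>c + 1 - |b|\<close>. These are the two terms of the maximum.\<close>

lemma attractor_connected_of_ge:
  assumes l: "cmod l > 1" "l\<^sup>2 + of_int b * l + of_int c = 0"
    and K: "attractor l (of_nat ` {0..m}) K"
    and m: "int m \<ge> max (c - \<bar>b\<bar> + 1) (\<bar>b\<bar> - 1)" and b: "b \<noteq> 0" "\<bar>b\<bar> \<le> c + 1"
  shows "connected K"
proof (rule attractor_connected_of_orbit_set[OF l(1) K])
  define \<sigma> where "\<sigma> = - sgn b"
  define w where "w = l + of_int (b + \<sigma>)"
  have \<sigma>: "\<sigma> = 1 \<or> \<sigma> = -1" "\<sigma> * b = - \<bar>b\<bar>" "\<sigma> * \<sigma> = 1"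
    using b by (auto simp: \<sigma>_def sgn_if)
  have lw: "l * w = - of_int c + of_int \<sigma> * l"
  proof -
    have "l * w = (l\<^sup>2 + of_int b * l + of_int c) - of_int c + of_int \<sigma> * l"
      by (simp add: w_def power2_eq_square algebra_simps)
    then show ?thesis by (simp add: l(2))
  qed
  have "of_int \<sigma> * w = of_int \<sigma> * l + of_int (\<sigma> * b + \<sigma> * \<sigma>)"
    by (simp add: w_def algebra_simps)
  also have "\<sigma> * b + \<sigma> * \<sigma> = 1 - \<bar>b\<bar>" using \<sigma>(2,3) by linarith
  finally have w: "l * w - of_int (\<bar>b\<bar> - c - 1) = of_int \<sigma> * w"
    unfolding lw by simp
  have \<sigma>w: "of_int \<sigma> * w \<in> {w, - w}" using \<sigma>(1) by auto
  show "bounded {1, w, - w}" by simp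
  show "1 \<in> {1, w, - w}" by simp
  show "\<exists>e::int. \<bar>e\<bar> \<le> int m \<and> l * z - of_int e \<in> {1, w, - w}" if z: "z \<in> {1, w, - w}" for z
  proof -
    consider "z = 1" | "z = w" | "z = - w" using z by blast
    then show ?thesis
    proof cases
      case 1
      have "\<bar>- (b + \<sigma>)\<bar> \<le> int m" using m b(1) by (auto simp: \<sigma>_def sgn_if)
      moreover have "l * z - of_int (- (b + \<sigma>)) = w" by (simp add: 1 w_def)
      ultimately show ?thesis by blast
    next
      case 2
      have "\<bar>\<bar>b\<bar> - c - 1\<bar> \<le> int m" using m b(2) by linarith
      moreover have "l * z - of_int (\<bar>b\<bar> - c - 1) \<in> {1, w, - w}" unfolding 2 w using \<sigma>w by blast
      ultimately show ?thesis by blast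
    next
      case 3
      have "\<bar>- (\<bar>b\<bar> - c - 1)\<bar> \<le> int m" using m b(2) by linarith
      have "l * z - of_int (- (\<bar>b\<bar> - c - 1)) = - (l * w - of_int (\<bar>b\<bar> - c - 1))"
        by (simp add: 3)
      then have "l * z - of_int (- (\<bar>b\<bar> - c - 1)) \<in> {1, w, - w}"
        unfolding w using \<sigma>w by auto
      with \<open>\<bar>- (\<bar>b\<bar> - c - 1)\<bar> \<le> int m\<close> show ?thesis by blast
    qed
  qed
qed

text \<open>Since \<open>l^2 = -c\<close>, the points run through the cycle 1, \<open>l\<close>, -1,
  \<open>-l\<close> with digits 0, \<open>1 - c\<close>, 0, \<open>c - 1\<close>.\<close>

lemma attractor_connected_of_ge_b_zero:
  assumes l: "cmod l > 1" "l\<^sup>2 + of_int b * l + of_int c = 0"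
    and K: "attractor l (of_nat ` {0..m}) K"
    and m: "int m \<ge> c - 1" and b: "b = 0" and c: "c \<ge> 1"
  shows "connected K"
proof (rule attractor_connected_of_orbit_set[OF l(1) K])
  have ll: "l * l = - of_int c" using l(2) b by (simp add: power2_eq_square eq_neg_iff_add_eq_0)
  show "bounded {1, l, - 1, - l}" by simp
  show "1 \<in> {1, l, - 1, - l}" by simp
  show "\<exists>e::int. \<bar>e\<bar> \<le> int m \<and> l * z - of_int e \<in> {1, l, - 1, - l}"
    if z: "z \<in> {1, l, - 1, - l}" for z
  proof -
    have "l * 1 - of_int 0 = l" "l * (- 1) - of_int 0 = - l"
      "l * l - of_int (1 - c) = - 1" "l * (- l) - of_int (c - 1) = 1"
      by (simp_all add: ll)
    moreover have "\<bar>0\<bar> \<le> int m" "\<bar>1 - c\<bar> \<le> int m" "\<bar>c - 1\<bar> \<le> int m"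
      using m c by linarith+
    moreover have "z = 1 \<or> z = - 1 \<or> z = l \<or> z = - l" using z by blast
    ultimately show ?thesis by (metis insertCI)
  qed
qed

section \<open>Transfer between the complex plane and the matrix action\<close>

lemma charpoly_2x2:
  "charpoly A = [:det A, - (A $ 1 $ 1 + A $ 2 $ 2), 1:]" for A :: "'a::comm_ring_1^2^2"
  by (simp add: charpoly_def det_2 mat_def map_matrix_def algebra_simps)

text \<open>Cayley-Hamilton in dimension two, applied to a vector.\<close>

lemma matrix_2x2_square_vector_mult:
  "A *v (A *v x) = (A $ 1 $ 1 + A $ 2 $ 2) *\<^sub>R (A *v x) - det A *\<^sub>R x" for A :: "real^2^2"
  by (simp add: vec_eq_iff forall_2 matrix_vector_mult_def sum_2 det_2 algebra_simps)

lemma eigenvalue_of_charpoly_root: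
  fixes A :: "int^2^2" and l :: complex
  assumes "charpoly A = [:c, b, 1:]" and root: "l\<^sup>2 + of_int b * l + of_int c = 0" and "Im l \<noteq> 0"
  shows "eigenvalue (map_matrix of_int A) l"
proof -
  let ?a = "\<lambda>i j. complex_of_int (A $ i $ j)"
  \<comment> \<open>This vector solves the first row of \<open>A u = l u\<close> identically; the
    second row is the characteristic equation. Its second entry is nonzero because \<open>l\<close>
    is not real.\<close>
  define u :: "complex^2" where "u = (\<chi> i. if i = 1 then ?a 1 2 else l - ?a 1 1)"
  have u: "u $ 1 = ?a 1 2" "u $ 2 = l - ?a 1 1" by (simp_all add: u_def)
  have bc: "b = - (A $ 1 $ 1 + A $ 2 $ 2)" "c = A $ 1 $ 1 * A $ 2 $ 2 - A $ 1 $ 2 * A $ 2 $ 1"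
    using assms(1) by (simp_all add: charpoly_2x2 det_2)
  have "u $ 2 \<noteq> 0" using \<open>Im l \<noteq> 0\<close> by (auto simp: u complex_eq_iff)
  then have "u \<noteq> 0" by auto
  moreover have "map_matrix of_int A *v u = l *s u"
    using root by (simp add: bc vec_eq_iff forall_2 matrix_vector_mult_def sum_2 map_matrix_def u
        power2_eq_square) algebra
  ultimately show ?thesis unfolding eigenvalue_def by blast
qed

text \<open>The conjugacy turns the digit maps on the complex plane into the affine maps of
  \<open>A\<close>. Fixed compact sets correspond in both directions because the inverse of
  \<open>\<psi>\<close> is also linear, so uniqueness of the attractor determines the definite
  description.\<close>

lemma self_affine_set_eq_image_attractor:
  fixes A :: "int^'n^'n" and \<psi> :: "complex \<Rightarrow> real^'n"
  defines "M \<equiv> map_matrix of_int A"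
  assumes \<psi>: "linear \<psi>" "bij \<psi>" and conj: "\<And>z. \<psi> (l * z) = M *v \<psi> z"
    and M: "invertible M" and l: "cmod l > 1" and K: "attractor l D K"
  shows "self_affine_set A (\<psi> ` D) = \<psi> ` K"
proof -
  let ?F = "\<lambda>T. \<Union>d\<in>\<psi> ` D. (\<lambda>x. matrix_inv M *v (x + d)) ` T"
  have l0: "l \<noteq> 0" using l by auto
  have matrix_inv_M: "matrix_inv M ** M = mat 1"
    using M unfolding invertible_def matrix_inv_def by (rule someI2_ex) blast
  have step: "matrix_inv M *v (\<psi> x + \<psi> d) = \<psi> ((x + d) / l)" for x d
  proof -
    have "\<psi> x + \<psi> d = M *v \<psi> ((x + d) / l)"
      using conj[of "(x + d) / l"] l0 by (simp add: linear_add[OF \<psi>(1)])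
    then show ?thesis using matrix_inv_M by (simp add: matrix_vector_mul_assoc)
  qed
  have image: "?F (\<psi> ` X) = \<psi> ` digit_step l D X" for X
    by (auto simp: digit_step_def step image_UN image_image)
  obtain g where g: "linear g" "g \<circ> \<psi> = id"
    using linear_injective_left_inverse[OF \<psi>(1)] \<psi>(2) bij_is_inj by blast
  have \<psi>g: "\<psi> (g y) = y" for y
    using g(2) \<psi>(2) by (metis bij_pointE comp_apply id_apply)
  have "self_affine_set A (\<psi> ` D) = (THE T. T \<noteq> {} \<and> compact T \<and> T = ?F T)"
    unfolding self_affine_set_def M_def ..
  also have "\<dots> = \<psi> ` K"
  proof (rule the_equality)
    show "\<psi> ` K \<noteq> {} \<and> compact (\<psi> ` K) \<and> \<psi> ` K = ?F (\<psi> ` K)"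
      unfolding image using K \<psi>(1)
      by (auto simp: attractor_def linear_conv_bounded_linear
          intro!: compact_continuous_image linear_continuous_on)
  next
    fix T assume T: "T \<noteq> {} \<and> compact T \<and> T = ?F T"
    have T_eq: "T = \<psi> ` g ` T" by (simp add: image_image \<psi>g)
    then have "\<psi> ` g ` T = \<psi> ` digit_step l D (g ` T)"
      using T image[of "g ` T"] by simp
    then have "g ` T = digit_step l D (g ` T)"
      using \<psi>(2) by (simp add: bij_is_inj inj_image_eq_iff)
    then have "attractor l D (g ` T)"
      using T g(1)
      by (simp add: attractor_def linear_conv_bounded_linear compact_continuous_image
          linear_continuous_on)
    then show "T = \<psi> ` K" using attractor_unique[OF l K] T_eq by metis
  qed
  finally show ?thesis .
qed

lemma connected_self_affine_set_iff:
  fixes A :: "int^2^2" and b c :: int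
  assumes char: "charpoly A = [:c, b, 1:]" and root: "l\<^sup>2 + of_int b * l + of_int c = 0"
    and im: "Im l \<noteq> 0" and l: "cmod l > 1" and v: "v \<noteq> 0"
    and K: "attractor l (of_nat ` {0..m}) K"
  shows "connected (self_affine_set A ((\<lambda>k. real k *\<^sub>R v) ` {0..m})) \<longleftrightarrow> connected K"
proof -
  define M :: "real^2^2" where "M = map_matrix of_int A"
  have bc: "b = - (A $ 1 $ 1 + A $ 2 $ 2)" "c = det A"
    using char by (simp_all add: charpoly_2x2)
  have "of_int b = - (M $ 1 $ 1 + M $ 2 $ 2)" and det: "of_int c = det M"
    by (simp_all add: bc M_def map_matrix_def det_2)
  then have MM: "M *v (M *v x) = - of_int b *\<^sub>R (M *v x) - of_int c *\<^sub>R x" for x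
    using matrix_2x2_square_vector_mult[of M x] by simp
  have "(cmod l)\<^sup>2 \<noteq> 0" using l by auto
  then have "det M \<noteq> 0" using det quadratic_root_parts(2)[OF root im] by simp
  then have inv: "invertible M" by (simp add: invertible_det_nz)
  \<comment> \<open>\<open>p z\<close> and \<open>q z\<close> are the real coordinates of
    \<open>z\<close> in the basis 1, \<open>l\<close>.\<close>
  define q p where "q = (\<lambda>z. Im z / Im l)" and "p = (\<lambda>z. Re z - Re l * (Im z / Im l))"
  have pq: "z = of_real (p z) + of_real (q z) * l" for z
    using im by (simp add: p_def q_def complex_eq_iff)
  define \<psi> where "\<psi> = (\<lambda>z. p z *\<^sub>R v + q z *\<^sub>R (M *v v))"
  have lin: "linear \<psi>"
    by (rule linearI) (auto simp: \<psi>_def p_def q_def algebra_simps add_divide_distrib)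
  have conj: "\<psi> (l * z) = M *v \<psi> z" for z
  proof -
    have "l * z = of_real (- of_int c * q z) + of_real (p z - of_int b * q z) * l"
    proof -
      have ll: "l * l = - of_int b * l - of_int c" using root by (simp add: power2_eq_square) algebra
      have "l * z = of_real (p z) * l + of_real (q z) * (l * l)"
        by (subst pq[of z]) (simp add: algebra_simps)
      then show ?thesis unfolding ll by (simp add: algebra_simps)
    qed
    then have pq_mult: "q (l * z) = p z - of_int b * q z" "p (l * z) = - of_int c * q z"
      using im by (simp_all add: q_def p_def)
    show ?thesis
      unfolding \<psi>_def pq_mult
      by (simp add: matrix_vector_right_distrib matrix_vector_mult_scaleR MM algebra_simps)
  qed
  \<comment> \<open>This makes the kernel of \<open>\<psi>\<close> an ideal of the field of complex
    numbers. It does not contain 1, since \<open>\<psi> 1 = v\<close> is nonzero, so it is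
    zero.\<close>
  have \<psi>_mult: "\<psi> (w * z) = p w *\<^sub>R \<psi> z + q w *\<^sub>R (M *v \<psi> z)" for w z
  proof -
    have "w * z = p w *\<^sub>R z + q w *\<^sub>R (l * z)"
      by (subst pq[of w]) (simp add: scaleR_conv_of_real algebra_simps)
    then show ?thesis by (simp add: linear_add[OF lin] linear_scale[OF lin] conj)
  qed
  have \<psi>1: "\<psi> 1 = v" by (simp add: \<psi>_def p_def q_def)
  have "inj \<psi>"
  proof (rule linear_injective_0[OF lin, THEN iffD2], intro allI impI)
    fix z assume "\<psi> z = 0"
    then have "\<psi> (inverse z * z) = 0" by (simp only: \<psi>_mult) simp
    then show "z = 0" using \<psi>1 v by (cases "z = 0") auto
  qed
  have "dim (UNIV :: (real^2) set) = dim (UNIV :: complex set)" by (simp add: dim_UNIV)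
  then have "surj \<psi>"
    using linear_injective_imp_surjective[OF lin \<open>inj \<psi>\<close>] by simp
  then have bij: "bij \<psi>" using \<open>inj \<psi>\<close> by (simp add: bij_def)
  have "\<psi> (of_nat k) = real k *\<^sub>R v" for k
    using linear_scale[OF lin, of "real k" 1] by (simp add: \<psi>1 scaleR_conv_of_real)
  then have "(\<lambda>k. real k *\<^sub>R v) ` {0..m} = \<psi> ` of_nat ` {0..m}"
    by (simp add: image_image)
  then have "self_affine_set A ((\<lambda>k. real k *\<^sub>R v) ` {0..m}) = \<psi> ` K"
    using self_affine_set_eq_image_attractor[OF lin bij _ _ l K, of A] conj inv
    by (simp add: M_def)
  moreover have "connected (\<psi> ` K) \<longleftrightarrow> connected K"
  proof -
    obtain g where g: "linear g" "g \<circ> \<psi> = id"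
      using linear_injective_left_inverse[OF lin \<open>inj \<psi>\<close>] by blast
    have "g ` \<psi> ` K = K" using g(2) by (simp add: image_comp)
    then show ?thesis
      using connected_linear_image[OF lin, of K] connected_linear_image[OF g(1), of "\<psi> ` K"] by auto
  qed
  ultimately show ?thesis by simp
qed

section \<open>The four cases\<close>

theorem theorem1p2:
  fixes A :: "int^2^2" and b c :: int and m :: nat and v :: "real^2"
  defines "D \<equiv> (\<lambda>k. real k *\<^sub>R v) ` {0..m}"
  assumes "expanding A"
    and "charpoly A = [:c, b, 1:]"
    and "m \<ge> 1"
    and "independent {v, map_matrix of_int A *v v}"
    and "b\<^sup>2 - 4 * c < 0"
  shows "(b\<^sup>2 = 3 * c \<longrightarrow>
            (connected (self_affine_set A D) \<longleftrightarrow> int m \<ge> max (c - \<bar>b\<bar> + 1) (\<bar>b\<bar> - 1))) \<and>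
         (b\<^sup>2 = 2 * c \<or> b\<^sup>2 = c \<longrightarrow>
            (connected (self_affine_set A D) \<longleftrightarrow> int m \<ge> c - \<bar>b\<bar> + 1)) \<and>
         (b = 0 \<longrightarrow>
            (connected (self_affine_set A D) \<longleftrightarrow> int m \<ge> c - 1))"
proof -
  define l where "l = Complex (- of_int b / 2) (sqrt (4 * of_int c - of_int (b\<^sup>2)) / 2)"
  have disc: "4 * real_of_int c - of_int (b\<^sup>2) > 0"
    using \<open>b\<^sup>2 - 4 * c < 0\<close> by linarith
  have root: "l\<^sup>2 + of_int b * l + of_int c = 0"
    using disc by (simp add: l_def complex_eq_iff power2_eq_square field_simps)
  have im: "Im l \<noteq> 0" using disc by (simp add: l_def)
  have l: "cmod l > 1"
    using eigenvalue_of_charpoly_root[OF assms(3) root im] \<open>expanding A\<close>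
    unfolding expanding_def by blast
  have "1 < (cmod l)\<^sup>2" using l by simp
  then have c: "c \<ge> 2" using quadratic_root_parts(2)[OF root im] by simp
  have v: "v \<noteq> 0"
    using \<open>independent {v, map_matrix of_int A *v v}\<close> dependent_zero[of "{v, map_matrix of_int A *v v}"]
    by auto
  obtain K where K: "attractor l (of_nat ` {0..m}) K"
    using attractor_exists[OF l, of "of_nat ` {0..m}"] by auto
  have conn: "connected (self_affine_set A D) \<longleftrightarrow> connected K"
    unfolding D_def by (rule connected_self_affine_set_iff[OF assms(3) root im l v K])
  have sq: "\<bar>b\<bar>\<^sup>2 = b\<^sup>2" by simp
  \<comment> \<open>From \<open>b^2 < 4 c \<le> (c + 1)^2\<close>; it fixes the sign of the digit
    \<open>|b| - c - 1\<close> in the sufficiency argument.\<close>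
  have b_le: "\<bar>b\<bar> \<le> c + 1"
  proof (rule power2_le_imp_le)
    have "(c + 1)\<^sup>2 = (c - 1)\<^sup>2 + 4 * c" by (simp add: power2_eq_square algebra_simps)
    then show "\<bar>b\<bar>\<^sup>2 \<le> (c + 1)\<^sup>2"
      using \<open>b\<^sup>2 - 4 * c < 0\<close> zero_le_power2[of "c - 1"] unfolding sq by linarith
  qed (use c in simp)
  \<comment> \<open>From \<open>4 b^2 \<le> 8 c \<le> (c + 2)^2\<close>; it says
    \<open>|b| - 1 \<le> c - |b| + 1\<close>, so in these cases the maximum is its first
    term.\<close>
  have double_le: "2 * \<bar>b\<bar> \<le> c + 2" if "b\<^sup>2 = 2 * c \<or> b\<^sup>2 = c"
  proof (rule power2_le_imp_le)
    have "(c + 2)\<^sup>2 = (c - 2)\<^sup>2 + 8 * c" by (simp add: power2_eq_square algebra_simps)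
    moreover have "(2 * \<bar>b\<bar>)\<^sup>2 = 4 * b\<^sup>2" by (simp add: power2_eq_square)
    ultimately show "(2 * \<bar>b\<bar>)\<^sup>2 \<le> (c + 2)\<^sup>2" using that c zero_le_power2[of "c - 2"] by linarith
  qed (use c in simp)
  note lower = l root im \<open>m \<ge> 1\<close> K _ c
  show ?thesis unfolding conn
  proof (intro conjI impI iffI)
    assume b: "b\<^sup>2 = 3 * c" and "connected K"
    have m: "int m \<ge> c - \<bar>b\<bar> + 1"
      by (rule connected_attractor_lower_bound_b_sq_3c[OF lower b]) fact
    have "int m \<ge> \<bar>b\<bar> - 1"
    \<comment> \<open>Failure of the second bound together with the first forces
      \<open>(c + 3)^2 \<le> 12 c\<close>, that is \<open>(c - 3)^2 \<le> 0\<close>. The only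
      exception is \<open>c = 3\<close>, \<open>|b| = 3\<close>, \<open>m = 1\<close>, which was
      excluded separately.\<close>
    proof (rule ccontr)
      assume *: "\<not> int m \<ge> \<bar>b\<bar> - 1"
      then have "c + 3 \<le> 2 * \<bar>b\<bar>" using m by linarith
      then have "(c + 3)\<^sup>2 \<le> (2 * \<bar>b\<bar>)\<^sup>2" using c by (intro power_mono) auto
      also have "\<dots> = 12 * c" using b by (simp add: power_mult_distrib)
      finally have "(c - 3)\<^sup>2 \<le> 0" by (simp add: power2_eq_square algebra_simps)
      then have c3: "c = 3" by simp
      then have "\<bar>b\<bar>\<^sup>2 = 3\<^sup>2" using b by simp
      then have b3: "\<bar>b\<bar> = 3" by (simp only: power2_eq_iff_nonneg abs_ge_zero)
      then have "m = 1" using * \<open>m \<ge> 1\<close> by linarith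
      then show False
        using attractor_not_connected_b_3_c_3[of l b K] l root im K b3 c3 \<open>connected K\<close> by simp
    qed
    with m show "int m \<ge> max (c - \<bar>b\<bar> + 1) (\<bar>b\<bar> - 1)" by simp
  next
    assume "b\<^sup>2 = 3 * c" and m: "int m \<ge> max (c - \<bar>b\<bar> + 1) (\<bar>b\<bar> - 1)"
    then have "b \<noteq> 0" using c by auto
    then show "connected K" using attractor_connected_of_ge[OF l root K m _ b_le] by blast
  next
    assume "b\<^sup>2 = 2 * c \<or> b\<^sup>2 = c" and "connected K"
    then show "int m \<ge> c - \<bar>b\<bar> + 1"
      using connected_attractor_lower_bound_b_sq_2c[OF lower]
        connected_attractor_lower_bound_b_sq_c[OF lower] by blast
  next
    assume b: "b\<^sup>2 = 2 * c \<or> b\<^sup>2 = c" and "int m \<ge> c - \<bar>b\<bar> + 1"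
    then have m: "int m \<ge> max (c - \<bar>b\<bar> + 1) (\<bar>b\<bar> - 1)" using double_le by linarith
    have "b \<noteq> 0" using b c by auto
    then show "connected K" using attractor_connected_of_ge[OF l root K m _ b_le] by blast
  next
    assume "b = 0" and "connected K"
    then show "int m \<ge> c - 1" using connected_attractor_lower_bound_b_zero[OF lower] by blast
  next
    assume "b = 0" and "int m \<ge> c - 1"
    then show "connected K" using attractor_connected_of_ge_b_zero[OF l root K] c by simp
  qed
qed

end
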